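(* Let $(q_k)_{k\ge1}$ be a sequence of positive integers with $q_{k+1}\ge q_k(q_k+1)$ for all $k\ge1$, and let $m\in\mathbb{N}$. For each $j\in\{1,\dots,m\}$ let $(\xi^{(j)}_k)_{k\ge1}$ be a sequence of independent random variables taking the values $0$ and $1$ with probabilities $p_{0k}$ and $p_{1k}$ respectively (the same for all $j$), where $p_{0k},p_{1k}\ge0$, $p_{0k}+p_{1k}=1$, and let $$\xi^{(j)}=\sum_{k=1}^\infty\frac{(-1)^{k+1}\xi^{(j)}_k}{q_k}.$$ Assume that $\xi^{(1)},\dots,\xi^{(m)}$ are mutually independent and put $\psi=\sum_{j=1}^m\xi^{(j)}$. Then $\psi$ has a distribution singular with respect to Lebesgue measure, its spectrum satisfies $\dim_H(S_\psi)=0$, and $$L_\psi=\limsup_{|t|\to\infty}|f_\psi(t)|>0,$$ where $f_\psi(t)=\mathsf{E}(e^{it\psi})$ is the characteristic function of $\psi$.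
   Context: The spectrum (topological support) $S_\psi$ of the distribution of a real random variable $\psi$ is its minimal closed support, i.e. $S_\psi=\{x\in\mathbb{R}:\ \mathsf{P}\{\psi\in(x-\varepsilon,x+\varepsilon)\}>0\ \ \forall\varepsilon>0\}$. $\dim_H$ denotes Hausdorff dimension. *)

theory Defs
  imports "HOL-Probability.Probability"
begin

definition mutually_singular :: "'a measure \<Rightarrow> 'a measure \<Rightarrow> bool" where
  "mutually_singular M N \<longleftrightarrow>
     sets M = sets N \<and> (\<exists>A\<in>sets M. emeasure M A = 0 \<and> emeasure N (space N - A) = 0)"

definition spectrum :: "real measure \<Rightarrow> real set" where
  "spectrum N = {x. \<forall>\<epsilon>>0. measure N {x - \<epsilon><..<x + \<epsilon>} > 0}"

text \<open>The usual conventions for the \<open>s\<close>-th power of a diameter are \<open>0 ^ 0 = 1\<close> for nonempty sets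
  and \<open>0\<close> for the empty set; they are spelled out because \<open>0 powr 0 = 0\<close>.\<close>

definition diam_powr :: "real \<Rightarrow> 'a::metric_space set \<Rightarrow> ennreal" where
  "diam_powr s U = (if U = {} then 0 else if s = 0 then 1 else ennreal (diameter U powr s))"

text \<open>Covering sets are required to be bounded because \<^const>\<open>diameter\<close> is only meaningful for those.\<close>

definition hausdorff_premeasure :: "real \<Rightarrow> real \<Rightarrow> 'a::metric_space set \<Rightarrow> ennreal" where
  "hausdorff_premeasure s \<delta> A =
     (INF U\<in>{U :: nat \<Rightarrow> 'a set. A \<subseteq> (\<Union>i. U i) \<and> (\<forall>i. bounded (U i) \<and> diameter (U i) \<le> \<delta>)}.
        \<Sum>i. diam_powr s (U i))"

definition hausdorff_measure :: "real \<Rightarrow> 'a::metric_space set \<Rightarrow> ennreal" where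
  "hausdorff_measure s A = (SUP \<delta>\<in>{0<..}. hausdorff_premeasure s \<delta> A)"

definition hausdorff_dim :: "'a::metric_space set \<Rightarrow> ennreal" where
  "hausdorff_dim A = (INF s\<in>{s. 0 \<le> s \<and> hausdorff_measure s A = 0}. ennreal s)"

text \<open>The sequences in the statement are indexed from 1, so the \<open>n\<close>-th summand (counted from 0)
  is the term with index \<open>Suc n\<close>.\<close>

definition alternating_series :: "(nat \<Rightarrow> nat) \<Rightarrow> (nat \<Rightarrow> real) \<Rightarrow> real" where
  "alternating_series q x = (\<Sum>n. (-1) ^ (Suc n + 1) * x (Suc n) / real (q (Suc n)))"

end

theory Submission
  imports Defs "HOL-Real_Asymp.Real_Asymp"
begin

text \<open>Write $a_n = q_{n+1}$, so that $a_{n+1} \ge a_n (a_n + 1)$; this forces $a_{n+1} \ge 2^{2^n}$.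

  Singularity and dimension: almost surely all digits lie in $\{0, 1\}$, and then the first $n$ terms
  of the $m$ series together contribute a number of the form $\sum_{i<n} (-1)^i c_i / a_i$ with
  $c_i \le m$. There are at most $(m+1)^n$ such numbers, while all remaining terms contribute at most
  $2m / a_n$. Hence for each $n$ the sum lies in a finite union of closed intervals,
  \<open>level_set m n\<close>, and therefore in the closed set $K$ that is the intersection of these unions.
  Since $(m+1)^n (4m / a_n)^s$ tends to $0$ for every $s > 0$, the set $K$ has Hausdorff
  dimension $0$ and Lebesgue measure $0$ (the case $s = 1$). Being closed and of full probability, it
  contains the spectrum.

  Characteristic function: let $P_n = a_0 \cdots a_{n-1}$ and $t_n = 2 \pi P_n$. Each $a_i$ with
  $i < n$ divides $P_n$, so the first $n$ terms of a single series change its phase at $t_n$ by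
  multiples of $2\pi$. The growth condition gives $3 P_n \le a_n$, so the next digit, of index $n$,
  turns the phase by an angle of at most $2\pi/3$, and every weighted mean of two unit vectors at such
  an angle has length at least $1/2$. The later terms
  move the phase by at most $2 t_n / a_{n+1} \le 4\pi / (3 a_n)$, which tends to $0$. So every
  factor has modulus at least $1/4$ at $t_n$ for large $n$ (\<open>char_series_ge_quarter\<close>), and by
  independence of the $m$ series the product has modulus at least $4^{-m}$ along $t_n$, which
  tends to infinity.\<close>

section \<open>Sets with efficient finite covers by balls\<close>

text \<open>Finite covers by balls of one common radius, for which both the radius and the $s$-th power sum of
  the diameters are as small as desired, for every $s > 0$. The full definition of Hausdorff measure
  allows countable covers with varying diameters; this restricted form serves the Hausdorff measures
  and Lebesgue measure alike.\<close>

definition cheaply_coverable :: "real set \<Rightarrow> bool" where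
  "cheaply_coverable K \<longleftrightarrow>
     (\<forall>s>0. \<forall>\<epsilon>>0. \<exists>C r. finite C \<and> 0 \<le> r \<and> 2 * r \<le> \<epsilon>
       \<and> real (card C) * (2 * r) powr s \<le> \<epsilon> \<and> K \<subseteq> (\<Union>c\<in>C. cball c r))"

lemma cheaply_coverableE:
  assumes "cheaply_coverable K" "s > 0" "\<epsilon> > 0"
  obtains C r where "finite C" "0 \<le> r" "2 * r \<le> \<epsilon>" "real (card C) * (2 * r) powr s \<le> \<epsilon>"
    "K \<subseteq> (\<Union>c\<in>C. cball c r)"
  using assms(1)[unfolded cheaply_coverable_def, rule_format, OF assms(2,3)] that by (elim exE conjE)

lemma cheaply_coverable_mono: "cheaply_coverable K \<Longrightarrow> A \<subseteq> K \<Longrightarrow> cheaply_coverable A"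
  unfolding cheaply_coverable_def by (meson subset_trans)

text \<open>A finite cover becomes an admissible sequence of sets when it is enumerated and continued by
  empty sets, whose diameter powers vanish by convention.\<close>

lemma hausdorff_premeasure_le_balls:
  fixes A C :: "real set"
  assumes s: "0 < s" and C: "finite C" "A \<subseteq> (\<Union>c\<in>C. cball c r)" and r: "0 \<le> r" "2 * r \<le> \<delta>"
  shows "hausdorff_premeasure s \<delta> A \<le> ennreal (real (card C) * (2 * r) powr s)"
proof -
  obtain f where f: "bij_betw f {..<card C} C"
    using C(1) ex_bij_betw_nat_finite[of C] by (auto simp: atLeast0LessThan)
  define U where "U = (\<lambda>i. if i < card C then cball (f i) r else {})"
  have diam: "diameter (U i) \<le> 2 * r" for i
    using r by (auto simp: U_def)
  have "A \<subseteq> (\<Union>i. U i)"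
  proof
    fix x assume "x \<in> A"
    then obtain c where c: "c \<in> C" "x \<in> cball c r" using C by auto
    then obtain i where "i < card C" "f i = c"
      using f unfolding bij_betw_def by (metis imageE lessThan_iff)
    then have "x \<in> U i" using c by (simp add: U_def)
    then show "x \<in> (\<Union>i. U i)" by blast
  qed
  moreover have "\<forall>i. bounded (U i) \<and> diameter (U i) \<le> \<delta>"
    using diam r by (force simp: U_def)
  ultimately have "hausdorff_premeasure s \<delta> A \<le> (\<Sum>i. diam_powr s (U i))"
    unfolding hausdorff_premeasure_def by (intro INF_lower) auto
  also have "\<dots> = (\<Sum>i<card C. diam_powr s (U i))"
    by (intro suminf_finite) (auto simp: U_def diam_powr_def)
  also have "\<dots> \<le> (\<Sum>i<card C. ennreal ((2 * r) powr s))"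
  proof (intro sum_mono)
    fix i
    show "diam_powr s (U i) \<le> ennreal ((2 * r) powr s)"
      using s diam[of i] by (auto simp: diam_powr_def intro!: ennreal_leI powr_mono2 diameter_ge_0)
        (auto simp: U_def)
  qed
  also have "\<dots> = ennreal (real (card C) * (2 * r) powr s)"
    by (simp add: ennreal_mult ennreal_of_nat_eq_real_of_nat)
  finally show ?thesis .
qed

lemma hausdorff_dim_cheaply_coverable:
  assumes "cheaply_coverable K"
  shows "hausdorff_dim K = 0"
proof -
  have zero: "hausdorff_measure s K = 0" if "s > 0" for s
  proof -
    have "hausdorff_premeasure s \<delta> K \<le> 0 + ennreal e" if "\<delta> > 0" "e > 0" for \<delta> e
    proof -
      have "min \<delta> e > 0" using that by simp
      then obtain C r where C: "finite C" "0 \<le> r" "2 * r \<le> min \<delta> e"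
        "real (card C) * (2 * r) powr s \<le> min \<delta> e" "K \<subseteq> (\<Union>c\<in>C. cball c r)"
        using cheaply_coverableE[OF assms \<open>s > 0\<close>] by metis
      have "hausdorff_premeasure s \<delta> K \<le> ennreal (real (card C) * (2 * r) powr s)"
        using C \<open>s > 0\<close> by (intro hausdorff_premeasure_le_balls) auto
      also have "\<dots> \<le> ennreal e" using C by (intro ennreal_leI) auto
      finally show ?thesis by simp
    qed
    then have "hausdorff_premeasure s \<delta> K \<le> 0" if "\<delta> > 0" for \<delta>
      by (rule ennreal_le_epsilon) (use that in auto)
    then show ?thesis
      unfolding hausdorff_measure_def by (intro antisym SUP_least) auto
  qed
  have "hausdorff_dim K \<le> 0 + ennreal e" if "e > 0" for e
    unfolding hausdorff_dim_def using that zero[of e] by (auto intro!: INF_lower)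
  then have "hausdorff_dim K \<le> 0"
    by (rule ennreal_le_epsilon) auto
  then show ?thesis by simp
qed

lemma emeasure_lborel_cheaply_coverable:
  assumes "cheaply_coverable K"
  shows "emeasure lborel K = 0"
proof -
  have "emeasure lborel K \<le> 0 + ennreal e" if "e > 0" for e
  proof -
    obtain C r where C: "finite C" "0 \<le> r" "real (card C) * (2 * r) powr 1 \<le> e"
      "K \<subseteq> (\<Union>c\<in>C. cball c r)"
      using cheaply_coverableE[OF assms zero_less_one \<open>e > 0\<close>] by metis
    have "emeasure lborel K \<le> emeasure lborel (\<Union>c\<in>C. cball c r)"
      using C by (intro emeasure_mono) auto
    also have "\<dots> \<le> (\<Sum>c\<in>C. emeasure lborel (cball c r))"
      using C by (intro emeasure_subadditive_finite) auto
    also have "\<dots> = (\<Sum>c\<in>C. ennreal (2 * r))"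
      using C by (simp add: cball_eq_atLeastAtMost)
    also have "\<dots> = ennreal (real (card C) * (2 * r) powr 1)"
      using C by (simp add: ennreal_mult ennreal_of_nat_eq_real_of_nat)
    also have "\<dots> \<le> ennreal e" using C by (intro ennreal_leI) auto
    finally show ?thesis by simp
  qed
  then have "emeasure lborel K \<le> 0"
    by (rule ennreal_le_epsilon) auto
  then show ?thesis by simp
qed

section \<open>Laws concentrated on a closed set\<close>

text \<open>A point outside a closed set has a whole neighbourhood outside it, and this neighbourhood is null.\<close>

lemma spectrum_subset_closed:
  fixes N :: "real measure"
  assumes "sets N = sets borel" "closed K" "AE x in N. x \<in> K"
  shows "spectrum N \<subseteq> K"
proof
  fix x assume x: "x \<in> spectrum N"
  show "x \<in> K"
  proof (rule ccontr)
    assume "x \<notin> K"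
    then obtain e where e: "e > 0" "ball x e \<subseteq> - K"
      using assms(2) by (meson ComplI open_Compl open_contains_ball)
    have "AE y in N. y \<notin> {x - e<..<x + e}"
      using assms(3) by eventually_elim (use e in \<open>auto simp: ball_eq_greaterThanLessThan\<close>)
    then have "{x - e<..<x + e} \<in> null_sets N"
      using assms(1) by (subst AE_iff_null_sets) auto
    then have "measure N {x - e<..<x + e} = 0" by (simp add: measure_def null_setsD1)
    then show False using x e by (force simp: spectrum_def)
  qed
qed

lemma singular_and_dim_zero_if_concentrated:
  fixes N :: "real measure"
  assumes N: "sets N = sets borel" and K: "closed K" "cheaply_coverable K" and ae: "AE x in N. x \<in> K"
  shows "mutually_singular N lborel" "hausdorff_dim (spectrum N) = 0"
proof -
  have sets: "- K \<in> sets N" using N K(1) by (simp add: borel_open open_Compl)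
  then have "- K \<in> null_sets N"
    using ae by (subst AE_iff_null_sets) auto
  moreover have "space lborel - (- K) = K" by auto
  ultimately show "mutually_singular N lborel"
    unfolding mutually_singular_def using N sets emeasure_lborel_cheaply_coverable[OF K(2)]
    by (intro conjI bexI[of _ "- K"]) (simp_all add: null_setsD1)
  show "hausdorff_dim (spectrum N) = 0"
    using spectrum_subset_closed[OF N K(1) ae] K(2)
    by (intro hausdorff_dim_cheaply_coverable) (rule cheaply_coverable_mono)
qed

section \<open>Denominators that grow doubly exponentially\<close>

locale fast_growth =
  fixes a :: "nat \<Rightarrow> nat"
  assumes pos_0: "a 0 > 0"
    and growth: "a (Suc n) \<ge> a n * (a n + 1)"
begin

lemma pos: "a n > 0"
proof (induction n)
  case (Suc n)
  then have "0 < a n * (a n + 1)" by simp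
  then show ?case using growth[of n] by linarith
qed (rule pos_0)

lemma double_le: "2 * a n \<le> a (Suc n)"
proof -
  have "2 * a n \<le> a n * (a n + 1)" using pos[of n] by (simp add: mult.commute)
  then show ?thesis using growth[of n] by linarith
qed

lemma geometric_le: "2 ^ i * a n \<le> a (i + n)"
proof (induction i)
  case (Suc i)
  then show ?case using double_le[of "i + n"] by simp
qed simp

lemma double_exponential_le: "2 ^ 2 ^ n \<le> a (Suc n)"
proof (induction n)
  case 0
  then show ?case using double_le[of 0] pos[of 0] by simp
next
  case (Suc n)
  have "(2::nat) ^ 2 ^ Suc n = 2 ^ 2 ^ n * 2 ^ 2 ^ n"
    by (simp add: power_add[symmetric] mult_2)
  also have "\<dots> \<le> a (Suc n) * (a (Suc n) + 1)"
    using Suc by (intro mult_mono) auto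
  also have "\<dots> \<le> a (Suc (Suc n))" by (rule growth)
  finally show ?case .
qed

lemma diverges: "filterlim a at_top sequentially"
proof (rule filterlim_at_top_mono[OF _ always_eventually])
  show "filterlim (\<lambda>n. n) at_top sequentially" by (rule filterlim_ident)
  show "\<forall>n. n \<le> a n"
  proof
    fix n
    have "n \<le> 2 ^ n" by (simp add: less_imp_le)
    also have "\<dots> \<le> 2 ^ n * a 0" using pos[of 0] by simp
    also have "\<dots> \<le> a n" using geometric_le[of n 0] by simp
    finally show "n \<le> a n" .
  qed
qed

text \<open>The constant $3$ keeps the angle $2\pi P_n/a_n$ below $2\pi/3$, hence away from $\pi$, where a fair
  digit would cancel completely. Once the inequality holds it persists, because
  $a_{n+1} \ge a_n(a_n + 1) \ge a_n \cdot 3 P_n$. It starts only at $n = 2$: for $1, 2, 6, 42, \dots$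
  one has $a_1 = 2 P_1$. There it follows from $(a_0 - 1)^2 \ge 0$.\<close>

lemma three_prod_le: "n \<ge> 2 \<Longrightarrow> 3 * (\<Prod>i<n. a i) \<le> a n"
proof (induction n rule: nat_induct_at_least)
  case base
  have "0 \<le> (int (a 0) - 1)\<^sup>2" by simp
  then have "3 * int (a 0) \<le> int (a 0) * (int (a 0) + 1) + 1"
    by (simp add: power2_eq_square algebra_simps)
  then have "int (3 * a 0) \<le> int (a 0 * (a 0 + 1) + 1)" by (simp add: algebra_simps)
  then have "3 * a 0 \<le> a 0 * (a 0 + 1) + 1" by (simp only: of_nat_le_iff)
  also have "\<dots> \<le> a 1 + 1" using growth[of 0] by simp
  finally have "a 1 * (3 * a 0) \<le> a 1 * (a 1 + 1)" by (intro mult_left_mono) auto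
  also have "\<dots> \<le> a 2" using growth[of 1] by (simp add: numeral_2_eq_2)
  finally show ?case by (simp add: numeral_2_eq_2 mult_ac)
next
  case (Suc n)
  have "3 * (\<Prod>i<Suc n. a i) = a n * (3 * (\<Prod>i<n. a i))" by simp
  also have "\<dots> \<le> a n * (a n + 1)" using Suc by (intro mult_left_mono) auto
  also have "\<dots> \<le> a (Suc n)" by (rule growth)
  finally show ?case .
qed

text \<open>As $a_{n+1} \ge 2 a_n$, the tail is dominated by a geometric series with first term $1/a_n$.\<close>

lemma tail_bound:
  fixes d :: "nat \<Rightarrow> real"
  assumes d: "\<And>i. \<bar>d i\<bar> \<le> 1 / real (a i)"
  shows "\<bar>(\<Sum>i. d i) - (\<Sum>i<n. d i)\<bar> \<le> 2 / real (a n)"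
proof -
  have bnd: "\<bar>d (i + n)\<bar> \<le> (1 / 2) ^ i * (1 / real (a n))" for i
  proof -
    have "2 ^ i * real (a n) \<le> real (a (i + n))"
      using geometric_le[of i n] by (metis of_nat_le_iff of_nat_mult of_nat_numeral of_nat_power)
    then have "1 / real (a (i + n)) \<le> 1 / (2 ^ i * real (a n))"
      using pos[of n] by (intro divide_left_mono) (auto intro!: mult_pos_pos simp: pos)
    then show ?thesis using d[of "i + n"] by (simp add: power_one_over)
  qed
  have geo: "(\<lambda>i. (1 / 2) ^ i * (1 / real (a n))) sums (2 * (1 / real (a n)))"
    using geometric_sums[of "1/2::real"] by (intro sums_mult2) simp
  have sm: "summable (\<lambda>i. d (i + n))"
    using bnd geo by (intro summable_comparison_test'[OF sums_summable[OF geo]]) auto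
  then have "summable d" by simp
  then have "(\<Sum>i. d i) - (\<Sum>i<n. d i) = (\<Sum>i. d (i + n))"
    by (subst suminf_split_initial_segment[of d n]) auto
  also have "\<bar>\<dots>\<bar> \<le> (\<Sum>i. \<bar>d (i + n)\<bar>)"
    using bnd by (intro summable_rabs summable_comparison_test'[OF sums_summable[OF geo]]) auto
  also have "\<dots> \<le> (\<Sum>i. (1 / 2) ^ i * (1 / real (a n)))"
    using bnd geo by (intro suminf_le summable_comparison_test'[OF sums_summable[OF geo]])
      (auto simp: sums_summable)
  also have "\<dots> = 2 / real (a n)" using geo by (simp add: sums_iff)
  finally show ?thesis .
qed

section \<open>The closed set carrying the distribution\<close>

definition centres :: "nat \<Rightarrow> nat \<Rightarrow> real set" where
  "centres m n = (\<lambda>c. \<Sum>i<n. (-1) ^ i * real (c i) / real (a i)) ` ({..<n} \<rightarrow>\<^sub>E {..m})"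

definition level_set :: "nat \<Rightarrow> nat \<Rightarrow> real set" where
  "level_set m n = (\<Union>c\<in>centres m n. cball c (2 * real m / real (a n)))"

lemma finite_centres: "finite (centres m n)"
  by (auto simp: centres_def intro!: finite_PiE)

lemma card_centres: "card (centres m n) \<le> (m + 1) ^ n"
proof -
  have "card (centres m n) \<le> card ({..<n} \<rightarrow>\<^sub>E {..m})"
    unfolding centres_def by (intro card_image_le finite_PiE) auto
  then show ?thesis by (simp add: card_PiE)
qed

lemma closed_level_set: "closed (level_set m n)"
  unfolding level_set_def using finite_centres by (intro closed_UN) auto

text \<open>Adding $m$ series with digits in $\{0, 1\}$ gives, position by position, digits in
  $\{0, \dots, m\}$; this is why only $(m+1)^n$ centres are needed.\<close>

lemma sum_series_in_level_set:
  fixes x :: "nat \<Rightarrow> nat \<Rightarrow> real"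
  assumes J: "finite J" "card J = m" and x: "\<And>j i. j \<in> J \<Longrightarrow> x j i \<in> {0, 1}"
  shows "(\<Sum>j\<in>J. \<Sum>i. (-1) ^ i * x j i / real (a i)) \<in> level_set m n"
proof -
  define d where "d = (\<lambda>j i. (-1) ^ i * x j i / real (a i))"
  define c where "c = (\<lambda>i\<in>{..<n}. card {j\<in>J. x j i = 1})"
  have digit: "(\<Sum>j\<in>J. x j i) = real (card {j\<in>J. x j i = 1})" for i
  proof -
    have "(\<Sum>j\<in>J. x j i) = (\<Sum>j\<in>J. if x j i = 1 then 1 else 0)"
      using x by (intro sum.cong) fastforce+
    also have "\<dots> = real (card {j\<in>J. x j i = 1})"
      using J by (simp add: sum.If_cases Int_def)
    finally show ?thesis .
  qed
  have "(\<Sum>j\<in>J. \<Sum>i<n. d j i) = (\<Sum>i<n. \<Sum>j\<in>J. d j i)" by (rule sum.swap)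
  also have "\<dots> = (\<Sum>i<n. (-1) ^ i * real (c i) / real (a i))"
    by (intro sum.cong) (auto simp: d_def c_def digit[symmetric] sum_distrib_left sum_divide_distrib)
  finally have eq: "(\<Sum>j\<in>J. \<Sum>i<n. d j i) = (\<Sum>i<n. (-1) ^ i * real (c i) / real (a i))" .
  have "c \<in> {..<n} \<rightarrow>\<^sub>E {..m}"
    using J by (auto simp: c_def intro!: card_mono)
  then have mem: "(\<Sum>j\<in>J. \<Sum>i<n. d j i) \<in> centres m n"
    unfolding eq centres_def by blast
  have "\<bar>d j i\<bar> \<le> 1 / real (a i)" if "j \<in> J" for i j
    using x[OF that, of i] by (auto simp: d_def abs_mult)
  then have tail: "\<bar>(\<Sum>i. d j i) - (\<Sum>i<n. d j i)\<bar> \<le> 2 / real (a n)" if "j \<in> J" for j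
    using that by (intro tail_bound)
  have "\<bar>(\<Sum>j\<in>J. \<Sum>i. d j i) - (\<Sum>j\<in>J. \<Sum>i<n. d j i)\<bar> \<le> (\<Sum>j\<in>J. 2 / real (a n))"
    unfolding sum_subtractf[symmetric] by (intro sum_norm_le[where 'a=real, simplified] tail)
  also have "\<dots> = 2 * real m / real (a n)" using J by simp
  finally have "(\<Sum>j\<in>J. \<Sum>i. d j i) \<in> cball (\<Sum>j\<in>J. \<Sum>i<n. d j i) (2 * real m / real (a n))"
    by (simp add: dist_real_def abs_minus_commute)
  then show ?thesis using mem unfolding level_set_def d_def by blast
qed

text \<open>The number of balls grows only exponentially in $n$, while their radius decreases doubly
  exponentially, so no positive power of the radius is outweighed by their number.\<close>

lemma cheaply_coverable_INT_level_set:
  assumes m: "m > 0"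
  shows "cheaply_coverable (\<Inter>n. level_set m n)"
  unfolding cheaply_coverable_def
proof (intro allI impI)
  fix s \<epsilon> :: real
  assume s: "s > 0" and \<epsilon>: "\<epsilon> > 0"
  define R where "R = (\<lambda>n. 2 * (2 * real m / real (a (Suc n))))"
  define B where "B = (\<lambda>n. 4 * real m / 2 ^ 2 ^ n)"
  have RB: "R n \<le> B n" "0 \<le> R n" for n
  proof -
    have "2 ^ 2 ^ n \<le> real (a (Suc n))"
      using double_exponential_le[of n] by (metis of_nat_le_iff of_nat_numeral of_nat_power)
    then have "4 * real m / real (a (Suc n)) \<le> 4 * real m / 2 ^ 2 ^ n"
      by (intro divide_left_mono) (auto intro!: mult_pos_pos simp: pos)
    then show "R n \<le> B n" "0 \<le> R n" by (auto simp: R_def B_def)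
  qed
  \<comment> \<open>The index is shifted by one because the doubly exponential bound concerns $a_{n+1}$.\<close>
  have lim0: "B \<longlonglongrightarrow> 0"
    unfolding B_def using m by real_asymp
  have lim1: "(\<lambda>n. (real m + 1) ^ Suc n * B n powr s) \<longlonglongrightarrow> 0"
    unfolding B_def using m s by real_asymp
  have "eventually (\<lambda>n. B n < \<epsilon> \<and> (real m + 1) ^ Suc n * B n powr s < \<epsilon>) sequentially"
    using order_tendstoD(2)[OF lim0 \<epsilon>] order_tendstoD(2)[OF lim1 \<epsilon>] by eventually_elim auto
  then obtain n where n: "B n < \<epsilon>" "(real m + 1) ^ Suc n * B n powr s < \<epsilon>"
    by (auto simp: eventually_sequentially)
  have "real (card (centres m (Suc n))) \<le> (real m + 1) ^ Suc n"
    using card_centres[of m "Suc n"]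
    by (metis of_nat_1 of_nat_add of_nat_le_iff of_nat_power)
  then have "real (card (centres m (Suc n))) * R n powr s \<le> (real m + 1) ^ Suc n * B n powr s"
    using RB s by (intro mult_mono powr_mono2) auto
  then show "\<exists>C r. finite C \<and> 0 \<le> r \<and> 2 * r \<le> \<epsilon> \<and> real (card C) * (2 * r) powr s \<le> \<epsilon>
      \<and> (\<Inter>n. level_set m n) \<subseteq> (\<Union>c\<in>C. cball c r)"
    using n RB[of n]
    by (intro exI[of _ "centres m (Suc n)"] exI[of _ "2 * real m / real (a (Suc n))"])
      (auto simp: finite_centres R_def level_set_def)
qed

end

section \<open>The characteristic function along a sequence\<close>

text \<open>The squared modulus is $1 - 2 p_0 p_1 (1 - \cos u)$, where $p_0 p_1 \le 1/4$ and, for these angles,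
  $1 - \cos u \le 3/2$.\<close>

lemma norm_two_point_char_ge_half:
  fixes u p0 p1 :: real
  assumes p: "p0 \<ge> 0" "p1 \<ge> 0" "p0 + p1 = 1" and u: "\<bar>u\<bar> \<le> 2 * pi / 3"
  shows "cmod (of_real p0 + of_real p1 * iexp u) \<ge> 1 / 2"
proof -
  have "cos (2 * pi / 3) \<le> cos \<bar>u\<bar>"
    using u by (intro cos_monotone_0_pi_le) auto
  then have c: "cos u \<ge> -1/2" by (simp add: cos_120)
  have "0 \<le> (p0 - p1)\<^sup>2" by simp
  then have "4 * (p0 * p1) \<le> (p0 + p1)\<^sup>2" by (simp add: power2_eq_square algebra_simps)
  then have pp: "4 * (p0 * p1) \<le> 1" using p by simp
  have "p0 * p1 * (1 - cos u) \<le> p0 * p1 * (3 / 2)"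
    using p c by (intro mult_left_mono) auto
  then have "(1 / 2)\<^sup>2 \<le> (p0 + p1)\<^sup>2 - 2 * (p0 * p1 * (1 - cos u))"
    using pp p by (simp add: power2_eq_square)
  also have "\<dots> = (p0 + p1 * cos u)\<^sup>2 + (p1 * sin u)\<^sup>2"
    using sin_cos_squared_add[of u] by algebra
  also have "\<dots> = (cmod (of_real p0 + of_real p1 * iexp u))\<^sup>2"
    by (simp add: cmod_power2 Re_exp Im_exp)
  finally show ?thesis by (rule power2_le_imp_le) simp
qed

lemma (in prob_space) char_two_point:
  fixes X :: "'a \<Rightarrow> real"
  assumes X[measurable]: "X \<in> borel_measurable M" and ae: "AE \<omega> in M. X \<omega> \<in> {0, 1}"
  shows "expectation (\<lambda>\<omega>. iexp (u * X \<omega>))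
    = of_real (prob {\<omega>\<in>space M. X \<omega> = 0}) + of_real (prob {\<omega>\<in>space M. X \<omega> = 1}) * iexp u"
proof -
  let ?I = "\<lambda>c. indicator {\<omega>\<in>space M. X \<omega> = c} :: 'a \<Rightarrow> real"
  have "expectation (\<lambda>\<omega>. iexp (u * X \<omega>)) = expectation (\<lambda>\<omega>. of_real (?I 0 \<omega>) + of_real (?I 1 \<omega>) * iexp u)"
  proof (rule integral_cong_AE)
    show "AE \<omega> in M. iexp (u * X \<omega>) = of_real (?I 0 \<omega>) + of_real (?I 1 \<omega>) * iexp u"
      using ae AE_space by eventually_elim auto
  qed measurable
  also have "\<dots> = expectation (\<lambda>\<omega>. of_real (?I 0 \<omega>)) + expectation (\<lambda>\<omega>. of_real (?I 1 \<omega>) * iexp u)"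
    by (intro Bochner_Integration.integral_add integrable_mult_left integrable_of_real)
      (auto intro!: integrable_real_indicator simp: less_top[symmetric])
  also have "\<dots> = of_real (expectation (?I 0)) + of_real (expectation (?I 1)) * iexp u"
    by (simp only: integral_mult_left_zero integral_complex_of_real)
  finally show ?thesis by simp
qed

lemma (in prob_space) norm_expectation_diff_le:
  fixes f g :: "'a \<Rightarrow> complex"
  assumes "integrable M f" "integrable M g" and "AE \<omega> in M. cmod (f \<omega> - g \<omega>) \<le> c"
  shows "cmod (expectation f - expectation g) \<le> c"
proof -
  have "cmod (expectation f - expectation g) = cmod (expectation (\<lambda>\<omega>. f \<omega> - g \<omega>))"
    using assms by simp
  also have "\<dots> \<le> expectation (\<lambda>\<omega>. cmod (f \<omega> - g \<omega>))"
    by (rule integral_norm_bound)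
  also have "\<dots> \<le> c"
    using assms by (intro integral_le_const) auto
  finally show ?thesis .
qed

context fast_growth
begin

text \<open>At $t = 2\pi a_0 \cdots a_{n-1}$ the terms before index $n$ drop out of the phase, as $t/a_i$ is a
  multiple of $2\pi$ for $i < n$. The terms after index $n$ are bounded by \<open>tail_bound\<close>, and
  $x \mapsto e^{ix}$ is Lipschitz with constant $1$.\<close>

lemma iexp_series_approx:
  fixes x :: "nat \<Rightarrow> real" and n :: nat
  assumes x: "\<And>i. x i \<in> {0, 1}"
  defines "t \<equiv> 2 * pi * real (\<Prod>i<n. a i)"
  shows "cmod (iexp (t * (\<Sum>i. (-1) ^ i * x i / real (a i))) - iexp (t * (-1) ^ n / real (a n) * x n))
    \<le> 2 * t / real (a (Suc n))"
proof -
  have t: "t \<ge> 0" unfolding t_def by (intro mult_nonneg_nonneg of_nat_0_le_iff) auto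
  define d where "d = (\<lambda>i. (-1) ^ i * x i / real (a i))"
  define R where "R = (\<Sum>i. d i) - (\<Sum>i<Suc n. d i)"
  have "\<bar>d i\<bar> \<le> 1 / real (a i)" for i
    using x[of i] by (auto simp: d_def abs_mult)
  then have R: "\<bar>R\<bar> \<le> 2 / real (a (Suc n))" unfolding R_def by (rule tail_bound)
  have "real (\<Prod>i<n. a i) * d i \<in> \<int>" if "i < n" for i
  proof -
    have "a i dvd (\<Prod>i<n. a i)" using that by (intro dvd_prodI) auto
    then obtain k where k: "(\<Prod>i<n. a i) = a i * k" by (elim dvdE)
    have "real (\<Prod>i<n. a i) * d i = (-1) ^ i * x i * real k"
      unfolding k d_def using pos[of i] by simp
    also have "\<dots> \<in> \<int>" using x[of i] by (auto intro!: Ints_mult Ints_power)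
    finally show ?thesis .
  qed
  then have "real (\<Prod>i<n. a i) * (\<Sum>i<n. d i) \<in> \<int>"
    unfolding sum_distrib_left by (intro Ints_sum) auto
  then obtain k where k: "real (\<Prod>i<n. a i) * (\<Sum>i<n. d i) = of_int k" by (elim Ints_cases)
  have "t * (\<Sum>i. d i) = 2 * pi * (real (\<Prod>i<n. a i) * (\<Sum>i<n. d i)) + (t * d n + t * R)"
    by (simp add: R_def t_def algebra_simps)
  then have eq: "t * (\<Sum>i. d i) = 2 * pi * of_int k + (t * d n + t * R)" unfolding k .
  have "iexp (t * (\<Sum>i. d i)) = cis (2 * pi * of_int k) * (iexp (t * d n) * iexp (t * R))"
    unfolding eq cis_conv_exp exp_add[symmetric] by (simp only: of_real_add distrib_left)
  also have "cis (2 * pi * of_int k) = 1" by (rule cis_multiple_2pi) simp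
  finally have "iexp (t * (\<Sum>i. d i)) - iexp (t * d n) = iexp (t * d n) * (iexp (t * R) - 1)"
    by (simp add: algebra_simps)
  then have "cmod (iexp (t * (\<Sum>i. d i)) - iexp (t * d n)) = cmod (iexp (t * R) - 1)"
    by (simp add: norm_mult)
  also have "\<dots> \<le> \<bar>t * R\<bar>" using iexp_approx1[of "t * R" 0] by simp
  also have "\<dots> = t * \<bar>R\<bar>" using t by (simp add: abs_mult)
  also have "\<dots> \<le> t * (2 / real (a (Suc n)))" using R t by (rule mult_left_mono)
  finally show ?thesis by (simp add: d_def mult_ac)
qed

text \<open>The average over the digit of index $n$ alone has modulus at least $1/2$, and replacing the whole
  series by this digit costs at most $4\pi/(3 a_n)$. The threshold $22$ is chosen so that this cost is at
  most $1/4$ already with the crude bound $\pi < 4$.\<close>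

lemma char_series_ge_quarter:
  fixes x :: "nat \<Rightarrow> 'a \<Rightarrow> real"
  assumes M: "prob_space M"
    and x[measurable]: "\<And>i. x i \<in> borel_measurable M" and Y[measurable]: "Y \<in> borel_measurable M"
    and digits: "\<And>i. AE \<omega> in M. x i \<omega> \<in> {0, 1}"
    and Y_eq: "\<And>\<omega>. \<omega> \<in> space M \<Longrightarrow> Y \<omega> = (\<Sum>i. (-1) ^ i * x i \<omega> / real (a i))"
    and n: "n \<ge> 2" "a n \<ge> 22"
  shows "cmod (char (distr M borel Y) (2 * pi * real (\<Prod>i<n. a i))) \<ge> 1 / 4"
proof -
  interpret prob_space M by (rule M)
  define P where "P = real (\<Prod>i<n. a i)"
  define t where "t = 2 * pi * P"
  define u where "u = t * (-1) ^ n / real (a n)"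
  have an: "real (a n) > 0" using pos[of n] by simp
  have P0: "P \<ge> 0" unfolding P_def by (rule of_nat_0_le_iff)
  have P: "3 * P \<le> real (a n)"
    using three_prod_le[OF n(1)] unfolding P_def by (metis of_nat_le_iff of_nat_mult of_nat_numeral)
  have Pn: "P / real (a n) \<le> 1 / 3" using P an by (simp add: field_simps)
  have "\<bar>u\<bar> = 2 * pi * (P / real (a n))" using P0 by (simp add: u_def t_def abs_mult)
  also have "\<dots> \<le> 2 * pi * (1 / 3)"
    using Pn by (intro mult_left_mono) auto
  finally have u: "\<bar>u\<bar> \<le> 2 * pi / 3" by simp
  have main: "cmod (expectation (\<lambda>\<omega>. iexp (u * x n \<omega>))) \<ge> 1 / 2"
  proof -
    have "prob {\<omega>\<in>space M. x n \<omega> = 0} + prob {\<omega>\<in>space M. x n \<omega> = 1}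
        = prob ({\<omega>\<in>space M. x n \<omega> = 0} \<union> {\<omega>\<in>space M. x n \<omega> = 1})"
      by (intro finite_measure_Union[symmetric]) auto
    also have "\<dots> = 1"
    proof (subst prob_eq_1)
      show "AE \<omega> in M. \<omega> \<in> {\<omega>\<in>space M. x n \<omega> = 0} \<union> {\<omega>\<in>space M. x n \<omega> = 1}"
        using digits[of n] AE_space by eventually_elim auto
    qed measurable
    finally show ?thesis
      unfolding char_two_point[OF x digits] using u by (intro norm_two_point_char_ge_half) auto
  qed
  have "real (a n * a n) \<le> real (a (Suc n))"
    using growth[of n] by (intro of_nat_mono) simp
  then have "2 * t / real (a (Suc n)) \<le> 2 * t / (real (a n) * real (a n))"
    using P0 an by (intro divide_left_mono) (auto simp: t_def intro!: mult_pos_pos pos)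
  also have "\<dots> = 4 * pi * (P / real (a n)) / real (a n)" by (simp add: t_def)
  also have "\<dots> \<le> 4 * pi * (1 / 3) / 22"
    using mult_left_mono[OF Pn, of "4 * pi"] n by (intro frac_le) auto
  also have "\<dots> \<le> 1 / 4" using pi_less_4 by simp
  finally have small: "2 * t / real (a (Suc n)) \<le> 1 / 4" .
  have "AE \<omega> in M. \<forall>i. x i \<omega> \<in> {0, 1}" using digits by (simp add: AE_all_countable)
  then have "AE \<omega> in M. cmod (iexp (t * Y \<omega>) - iexp (u * x n \<omega>)) \<le> 1 / 4"
    using AE_space
  proof eventually_elim
    case (elim \<omega>)
    then have "cmod (iexp (t * Y \<omega>) - iexp (u * x n \<omega>)) \<le> 2 * t / real (a (Suc n))"
      unfolding Y_eq[OF elim(2)] u_def t_def P_def by (intro iexp_series_approx) auto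
    then show ?case using small by linarith
  qed
  then have "cmod (expectation (\<lambda>\<omega>. iexp (t * Y \<omega>)) - expectation (\<lambda>\<omega>. iexp (u * x n \<omega>))) \<le> 1 / 4"
    by (intro norm_expectation_diff_le integrable_iexp) auto
  then have "cmod (expectation (\<lambda>\<omega>. iexp (t * Y \<omega>))) \<ge> 1 / 4"
    using main norm_triangle_ineq2[of "expectation (\<lambda>\<omega>. iexp (u * x n \<omega>))" "expectation (\<lambda>\<omega>. iexp (t * Y \<omega>))"]
    by (simp add: norm_minus_commute)
  then show ?thesis
    unfolding char_def by (subst integral_distr) (auto simp: t_def P_def)
qed

lemma filterlim_prod_at_infinity: "filterlim (\<lambda>n. 2 * pi * real (\<Prod>i<n. a i)) at_infinity sequentially"
proof -
  have "filterlim (\<lambda>n. \<Prod>i<n. a i) at_top sequentially"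
  proof (subst filterlim_sequentially_Suc[symmetric], rule filterlim_at_top_mono[OF diverges always_eventually])
    show "\<forall>n. a n \<le> (\<Prod>i<Suc n. a i)"
    proof
      fix n
      have "1 \<le> (\<Prod>i<n. a i)" using pos by (intro prod_ge_1) (simp add: Suc_le_eq)
      then have "1 * a n \<le> (\<Prod>i<n. a i) * a n" by (rule mult_right_mono) simp
      then show "a n \<le> (\<Prod>i<Suc n. a i)" by simp
    qed
  qed
  then have "filterlim (\<lambda>n. real (\<Prod>i<n. a i)) at_top sequentially"
    by (rule filterlim_compose[OF filterlim_real_sequentially])
  then have "filterlim (\<lambda>n. 2 * pi * real (\<Prod>i<n. a i)) at_top sequentially"
    by (intro filterlim_tendsto_pos_mult_at_top[OF tendsto_const]) auto
  then show ?thesis by (rule filterlim_at_top_imp_at_infinity)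
qed

end

section \<open>Sums of independent alternating series\<close>

lemma Limsup_ge_along_sequence:
  fixes f :: "'a \<Rightarrow> ereal"
  assumes "filterlim t F sequentially" "eventually (\<lambda>n. f (t n) \<ge> c) sequentially"
  shows "Limsup F f \<ge> c"
proof (rule ccontr)
  assume "\<not> c \<le> Limsup F f"
  then have "eventually (\<lambda>x. f x < c) F" by (intro Limsup_lessD) simp
  then have "eventually (\<lambda>n. f (t n) < c) sequentially"
    using assms(1) by (rule eventually_compose_filterlim)
  with assms(2) have "eventually (\<lambda>n. False) sequentially"
    by eventually_elim simp
  then show False by simp
qed

theorem theorem3:
  fixes M :: "'a measure"
    and q :: "nat \<Rightarrow> nat"
    and m :: nat
    and p0 p1 :: "nat \<Rightarrow> real"
    and X :: "nat \<Rightarrow> nat \<Rightarrow> 'a \<Rightarrow> real"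
    and \<xi> :: "nat \<Rightarrow> 'a \<Rightarrow> real"
    and \<psi> :: "'a \<Rightarrow> real"
  assumes "prob_space M"
    and "\<And>k. k \<ge> 1 \<Longrightarrow> q k > 0"
    and "\<And>k. k \<ge> 1 \<Longrightarrow> q (Suc k) \<ge> q k * (q k + 1)"
    and "m \<ge> 1"
    and "\<And>k. k \<ge> 1 \<Longrightarrow> p0 k \<ge> 0 \<and> p1 k \<ge> 0 \<and> p0 k + p1 k = 1"
    and "\<And>j. j \<in> {1..m} \<Longrightarrow> prob_space.indep_vars M (\<lambda>_. borel) (X j) {1..}"
    and "\<And>j k. j \<in> {1..m} \<Longrightarrow> k \<ge> 1 \<Longrightarrow> measure M {\<omega> \<in> space M. X j k \<omega> = 0} = p0 k"
    and "\<And>j k. j \<in> {1..m} \<Longrightarrow> k \<ge> 1 \<Longrightarrow> measure M {\<omega> \<in> space M. X j k \<omega> = 1} = p1 k"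
    and "\<And>j \<omega>. j \<in> {1..m} \<Longrightarrow> \<omega> \<in> space M \<Longrightarrow> \<xi> j \<omega> = alternating_series q (\<lambda>k. X j k \<omega>)"
    and "prob_space.indep_vars M (\<lambda>_. borel) \<xi> {1..m}"
    and "\<And>\<omega>. \<omega> \<in> space M \<Longrightarrow> \<psi> \<omega> = (\<Sum>j=1..m. \<xi> j \<omega>)"
  shows "mutually_singular (distr M borel \<psi>) lborel
    \<and> hausdorff_dim (spectrum (distr M borel \<psi>)) = 0
    \<and> Limsup at_infinity (\<lambda>t::real. ereal (cmod (char (distr M borel \<psi>) t))) > 0"
proof -
  note M = assms(1)
  interpret prob_space M by (rule M)
  define a where "a = (\<lambda>n. q (Suc n))"
  interpret fast_growth a
    by unfold_locales (use assms(2,3) in \<open>auto simp: a_def\<close>)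
  define x where "x = (\<lambda>j i. X j (Suc i))"
  define N where "N = distr M borel \<psi>"
  have x[measurable]: "x j i \<in> borel_measurable M" if "j \<in> {1..m}" for j i
    using assms(6)[OF that] by (auto simp: indep_vars_def2 x_def)
  have \<xi>[measurable]: "\<xi> j \<in> borel_measurable M" if "j \<in> {1..m}" for j
    using assms(10) that by (auto simp: indep_vars_def2)
  have \<xi>_eq: "\<xi> j \<omega> = (\<Sum>i. (-1) ^ i * x j i \<omega> / real (a i))" if "j \<in> {1..m}" "\<omega> \<in> space M" for j \<omega>
    using assms(9)[OF that] by (simp add: alternating_series_def x_def a_def)
  have \<psi>: "\<psi> \<in> borel_measurable M"
  proof -
    have "(\<lambda>\<omega>. \<Sum>j=1..m. \<xi> j \<omega>) \<in> borel_measurable M" by measurable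
    then show ?thesis using assms(11) by (subst measurable_cong) auto
  qed
  have digits: "AE \<omega> in M. x j i \<omega> \<in> {0, 1}" if j: "j \<in> {1..m}" for j i
  proof -
    note [measurable] = x[OF j]
    have "prob ({\<omega>\<in>space M. x j i \<omega> = 0} \<union> {\<omega>\<in>space M. x j i \<omega> = 1})
        = prob {\<omega>\<in>space M. x j i \<omega> = 0} + prob {\<omega>\<in>space M. x j i \<omega> = 1}"
      by (intro finite_measure_Union) auto
    also have "\<dots> = 1"
      using assms(5)[of "Suc i"] assms(7,8)[OF j, of "Suc i"] by (simp add: x_def)
    finally have "AE \<omega> in M. \<omega> \<in> {\<omega>\<in>space M. x j i \<omega> = 0} \<union> {\<omega>\<in>space M. x j i \<omega> = 1}"
      by (subst (asm) prob_eq_1) auto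
    then show ?thesis by eventually_elim auto
  qed
  have "AE \<omega> in M. \<forall>j\<in>{1..m}. \<forall>i. x j i \<omega> \<in> {0, 1}"
    using digits by (intro AE_finite_allI) (auto simp: AE_all_countable)
  then have "AE \<omega> in M. \<psi> \<omega> \<in> (\<Inter>n. level_set m n)"
    using AE_space
  proof eventually_elim
    case (elim \<omega>)
    then have "\<psi> \<omega> = (\<Sum>j=1..m. \<Sum>i. (-1) ^ i * x j i \<omega> / real (a i))"
      using assms(11) \<xi>_eq by auto
    moreover have "\<dots> \<in> level_set m n" for n
      using elim by (intro sum_series_in_level_set) auto
    ultimately show ?case by simp
  qed
  moreover have closed: "closed (\<Inter>n. level_set m n)"
    using closed_level_set by (intro closed_INT) auto
  ultimately have "AE y in N. y \<in> (\<Inter>n. level_set m n)"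
    unfolding N_def using \<psi> borel_closed[OF closed]
    by (subst AE_distr_iff) (simp_all only: Collect_mem_eq space_borel UNIV_I simp_thms)
  moreover have "sets N = sets borel" by (simp add: N_def)
  moreover have "cheaply_coverable (\<Inter>n. level_set m n)"
    using assms(4) by (intro cheaply_coverable_INT_level_set) auto
  ultimately have "mutually_singular N lborel" "hausdorff_dim (spectrum N) = 0"
    using closed by (blast intro: singular_and_dim_zero_if_concentrated)+
  moreover have "Limsup at_infinity (\<lambda>t. ereal (cmod (char N t))) \<ge> ereal ((1 / 4) ^ m)"
  proof (rule Limsup_ge_along_sequence[OF filterlim_prod_at_infinity])
    have N_sum: "N = distr M borel (\<lambda>\<omega>. \<Sum>j=1..m. \<xi> j \<omega>)"
      unfolding N_def using assms(11) by (intro distr_cong) auto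
    have "eventually (\<lambda>n. a n \<ge> 22) sequentially"
      using diverges unfolding filterlim_at_top by blast
    then show "eventually (\<lambda>n. ereal ((1 / 4) ^ m)
        \<le> ereal (cmod (char N (2 * pi * real (\<Prod>i<n. a i))))) sequentially"
      using eventually_ge_at_top[of 2]
    proof eventually_elim
      case (elim n)
      let ?t = "2 * pi * real (\<Prod>i<n. a i)"
      have "(1 / 4) ^ m = (\<Prod>j=1..m. 1 / 4 :: real)"
        by (simp only: prod_constant card_atLeastAtMost diff_Suc_1)
      also have "\<dots> \<le> (\<Prod>j=1..m. cmod (char (distr M borel (\<xi> j)) ?t))"
      proof (rule prod_mono, rule conjI)
        fix j assume j: "j \<in> {1..m}"
        show "1 / 4 \<le> cmod (char (distr M borel (\<xi> j)) ?t)"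
          using elim by (intro char_series_ge_quarter[where x = "x j"] M x \<xi> digits \<xi>_eq j)
      qed simp
      also have "\<dots> = cmod (char N ?t)"
        unfolding N_sum char_distr_sum[OF assms(10)] by (rule prod_norm)
      finally show ?case by (simp only: ereal_less_eq)
    qed
  qed
  then have "Limsup at_infinity (\<lambda>t. ereal (cmod (char N t))) > 0"
    by (rule less_le_trans[rotated]) simp
  ultimately show ?thesis unfolding N_def by (intro conjI)
qed

end
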